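(* Let $n \geq k \geq 2$ be integers. If a Steiner structure $S_2[2,k,n]$ exists, then a Steiner system $S(3,2^k,2^n)$ exists.
   Context: For a prime power $q$ and integers $n\ge k\ge 0$, $\mathcal{G}_q(n,k)$ denotes the set of all $k$-dimensional subspaces of $\mathbb{F}_q^n$. A Steiner structure $S_q[r,k,n]$ is a collection (set) $\mathbb{S}\subseteq \mathcal{G}_q(n,k)$ such that each element of $\mathcal{G}_q(n,r)$ is contained in exactly one element of $\mathbb{S}$. A Steiner system $S(r,k,n)$ is a collection of $k$-subsets (blocks) of an $n$-set such that each $r$-subset of the $n$-set is contained in exactly one block. *)

theory Defs
  imports "Jordan_Normal_Form.VS_Connect"
begin

text \<open>
  A field \<open>'a\<close> with \<open>card (UNIV :: 'a set) = q\<close> serves as \<open>F\<^sub>q\<close>, so \<open>q\<close> is not a separate parameter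
  of the first two definitions.
\<close>

definition grassmannian :: "nat \<Rightarrow> nat \<Rightarrow> 'a::field vec set set" where
  "grassmannian n k =
     {W. VectorSpace.subspace class_ring W (module_vec TYPE('a) n) \<and>
         vectorspace.dim class_ring ((module_vec TYPE('a) n)\<lparr>carrier := W\<rparr>) = k}"

definition steiner_structure :: "nat \<Rightarrow> nat \<Rightarrow> nat \<Rightarrow> 'a::field vec set set \<Rightarrow> bool" where
  "steiner_structure r k n SS \<longleftrightarrow>
     SS \<subseteq> grassmannian n k \<and>
     (\<forall>U \<in> grassmannian n r. \<exists>!W. W \<in> SS \<and> U \<subseteq> W)"

definition steiner_system :: "nat \<Rightarrow> nat \<Rightarrow> nat \<Rightarrow> 'p set \<Rightarrow> 'p set set \<Rightarrow> bool" where
  "steiner_system r k n X \<B> \<longleftrightarrow>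
     finite X \<and> card X = n \<and>
     (\<forall>B \<in> \<B>. B \<subseteq> X \<and> card B = k) \<and>
     (\<forall>T. T \<subseteq> X \<and> card T = r \<longrightarrow> (\<exists>!B. B \<in> \<B> \<and> T \<subseteq> B))"

end

theory Submission
  imports Defs
begin

text \<open>
  The Steiner system has the vectors of \<open>F\<^sub>2\<^sup>n\<close> as points and the cosets of the members
  of the Steiner structure as blocks. Translating three distinct points \<open>a\<close>, \<open>b\<close>, \<open>c\<close> by \<open>a\<close>
  gives \<open>0\<close>, \<open>a + b\<close>, \<open>a + c\<close>, and the last two vectors are nonzero and distinct. Over \<open>F\<^sub>2\<close> this
  already makes them linearly independent, so they span a plane \<open>{0, a + b, a + c, b + c}\<close>, which
  lies in exactly one member \<open>W\<close> of the Steiner structure. A coset of a member that contains the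
  three points is the translate by \<open>a\<close> of a member that contains this plane. So \<open>a + W\<close> is the one
  and only block through \<open>a\<close>, \<open>b\<close> and \<open>c\<close>.

  Dimensions enter only through the count \<open>card W = 2 ^ dim W\<close> (\<open>card_carrier_eq_power_dim\<close>). It
  gives the number of points and the block size, and it also shows that the four-element plane has
  dimension \<open>2\<close>, without an argument about linear independence. Finally, the points are numbered,
  since the system is asked for on a set of natural numbers.
\<close>

section \<open>Counting the vectors of a subspace\<close>

text \<open>
  Each vector has a unique coordinate function with respect to a basis. If the field is infinite,
  the equation still holds: both sides are then \<open>0\<close>, or \<open>1\<close> in dimension \<open>0\<close>.
\<close>
lemma (in vectorspace) card_carrier_eq_power_dim:
  assumes "fin_dim"
  shows "card (carrier V) = card (carrier K) ^ dim"
proof -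
  obtain \<beta> where fin: "finite \<beta>" and \<beta>: "basis \<beta>"
    using finite_basis_exists[OF assms] by blast
  have sub: "\<beta> \<subseteq> carrier V"
    using \<beta> by (simp add: basis_def)
  have coord: "\<exists>!a. a \<in> \<beta> \<rightarrow>\<^sub>E carrier K \<and> lincomb a \<beta> = v" if "v \<in> carrier V" for v
    using basis_criterion[OF fin sub] \<beta> that by blast
  have closed: "lincomb a \<beta> \<in> carrier V" if "a \<in> \<beta> \<rightarrow>\<^sub>E carrier K" for a
    using lincomb_closed[OF sub] that by (auto simp: PiE_def)
  have "bij_betw (\<lambda>a. lincomb a \<beta>) (\<beta> \<rightarrow>\<^sub>E carrier K) (carrier V)"
    unfolding bij_betw_def
  proof
    show "inj_on (\<lambda>a. lincomb a \<beta>) (\<beta> \<rightarrow>\<^sub>E carrier K)"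
      using coord closed by (metis (mono_tags, lifting) inj_onI)
    show "(\<lambda>a. lincomb a \<beta>) ` (\<beta> \<rightarrow>\<^sub>E carrier K) = carrier V"
      using coord closed by blast
  qed
  then have "card (carrier V) = card (\<beta> \<rightarrow>\<^sub>E carrier K)"
    by (simp add: bij_betw_same_card)
  then show ?thesis
    by (simp add: card_funcsetE[OF fin] dim_basis[OF fin \<beta>])
qed

lemma (in vectorspace) fin_dim_if_finite_carrier:
  assumes "finite (carrier V)"
  shows "fin_dim"
proof -
  have "span (carrier V) = carrier V"
    using in_own_span[of "carrier V"] span_is_subset2[of "carrier V"] by auto
  then show ?thesis
    using assms unfolding fin_dim_def by blast
qed

lemma card_carrier_vec:
  "card (carrier_vec n :: 'a::field vec set) = card (UNIV :: 'a set) ^ n"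
proof -
  interpret vec_space "TYPE('a)" n .
  interpret vectorspace class_ring "module_vec TYPE('a) n" by (rule vec_vs)
  show ?thesis
    using card_carrier_eq_power_dim fin_dim dim_is_n by (simp add: module_vec_simps)
qed

lemma card_subspace_eq_power_dim:
  fixes W :: "'a::field vec set"
  assumes W: "VectorSpace.subspace class_ring W (module_vec TYPE('a) n)"
    and "finite W"
  shows "card W = card (UNIV :: 'a set) ^
           vectorspace.dim class_ring ((module_vec TYPE('a) n)\<lparr>carrier := W\<rparr>)"
proof -
  interpret S: vectorspace class_ring "(module_vec TYPE('a) n)\<lparr>carrier := W\<rparr>"
    using vectorspace.subspace_is_vs[OF vec_vs W] .
  show ?thesis
    using S.card_carrier_eq_power_dim S.fin_dim_if_finite_carrier \<open>finite W\<close> by simp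
qed

section \<open>Vector spaces over the field with two elements\<close>

lemma two_element_field_cases:
  fixes x :: "'a::field"
  assumes "card (UNIV :: 'a set) = 2"
  shows "x = 0 \<or> x = 1"
proof -
  have "finite (UNIV :: 'a set)"
    using assms by (metis card.infinite zero_neq_numeral)
  then have "{0, 1} = (UNIV :: 'a set)"
    using assms by (intro card_subset_eq) auto
  then show ?thesis by blast
qed

lemma two_element_field_two_eq_zero:
  assumes "card (UNIV :: 'a::field set) = 2"
  shows "(2 :: 'a) = 0"
proof -
  have "(2 :: 'a) \<noteq> 1"
    by (metis add_cancel_right_right one_add_one zero_neq_one)
  then show ?thesis
    using two_element_field_cases[OF assms] by blast
qed

lemma two_element_field_add_self:
  fixes x :: "'a::field"
  assumes "card (UNIV :: 'a set) = 2"
  shows "x + x = 0"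
  using two_element_field_two_eq_zero[OF assms] by (metis mult_2 mult_zero_left)

lemma two_element_field_add_cancel_left:
  fixes x y :: "'a::field"
  assumes "card (UNIV :: 'a set) = 2"
  shows "x + (x + y) = y"
  using two_element_field_add_self[OF assms, of x] by (metis add.assoc add_0)

lemma vec_add_self:
  fixes v :: "'a::field vec"
  assumes two: "card (UNIV :: 'a set) = 2" and v: "v \<in> carrier_vec n"
  shows "v + v = 0\<^sub>v n"
  using v by (intro eq_vecI) (auto simp: two_element_field_two_eq_zero[OF two])

lemma vec_add_cancel_left:
  fixes v w :: "'a::field vec"
  assumes two: "card (UNIV :: 'a set) = 2" and v: "v \<in> carrier_vec n" and w: "w \<in> carrier_vec n"
  shows "v + (v + w) = w"
  using v w by (intro eq_vecI) (auto simp: two_element_field_add_cancel_left[OF two])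

lemma vec_add_eq_zero_iff:
  fixes v w :: "'a::field vec"
  assumes two: "card (UNIV :: 'a set) = 2" and v: "v \<in> carrier_vec n" and w: "w \<in> carrier_vec n"
  shows "v + w = 0\<^sub>v n \<longleftrightarrow> v = w"
  using vec_add_cancel_left[OF two v w] vec_add_self[OF two v] v by (metis right_zero_vec)

text \<open>Closure under scalars is free, because \<open>0\<close> and \<open>1\<close> are the only ones.\<close>
lemma subspace_iff_add_closed:
  fixes W :: "'a::field vec set"
  assumes two: "card (UNIV :: 'a set) = 2"
  shows "VectorSpace.subspace class_ring W (module_vec TYPE('a) n) \<longleftrightarrow>
    W \<subseteq> carrier_vec n \<and> 0\<^sub>v n \<in> W \<and> (\<forall>v\<in>W. \<forall>w\<in>W. v + w \<in> W)"
proof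
  assume "VectorSpace.subspace class_ring W (module_vec TYPE('a) n)"
  then have "submodule class_ring W (module_vec TYPE('a) n)"
    by (simp add: VectorSpace.subspace_def)
  then show "W \<subseteq> carrier_vec n \<and> 0\<^sub>v n \<in> W \<and> (\<forall>v\<in>W. \<forall>w\<in>W. v + w \<in> W)"
    unfolding submodule_def by (auto simp: module_vec_simps)
next
  assume W: "W \<subseteq> carrier_vec n \<and> 0\<^sub>v n \<in> W \<and> (\<forall>v\<in>W. \<forall>w\<in>W. v + w \<in> W)"
  have "c \<cdot>\<^sub>v v \<in> W" if "v \<in> W" for c v
  proof -
    have "v \<in> carrier_vec n" using W that by blast
    then have "0 \<cdot>\<^sub>v v = 0\<^sub>v n" by (intro eq_vecI) auto
    then show ?thesis
      using two_element_field_cases[OF two, of c] W that by auto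
  qed
  then have "submodule class_ring W (module_vec TYPE('a) n)"
    using W vec_module unfolding submodule_def by (auto simp: module_vec_simps)
  then show "VectorSpace.subspace class_ring W (module_vec TYPE('a) n)"
    by (simp add: VectorSpace.subspace_def vec_vs)
qed

text \<open>
  Since \<open>d \<mapsto> 2 ^ d\<close> is injective, a dimension can be recognised by counting. In this form, membership
  in the Grassmannian is checked without bases.
\<close>
lemma grassmannian_iff_add_closed:
  fixes W :: "'a::field vec set"
  assumes two: "card (UNIV :: 'a set) = 2"
  shows "W \<in> grassmannian n k \<longleftrightarrow>
    W \<subseteq> carrier_vec n \<and> 0\<^sub>v n \<in> W \<and> (\<forall>v\<in>W. \<forall>w\<in>W. v + w \<in> W) \<and> card W = 2 ^ k"
proof -
  have fin: "finite W" if "W \<subseteq> carrier_vec n"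
    using that card_carrier_vec[of n, where 'a = 'a] two
    by (metis card.infinite finite_subset power_not_zero zero_neq_numeral)
  show ?thesis
    using card_subspace_eq_power_dim[of W n] fin
    by (auto simp: grassmannian_def subspace_iff_add_closed[OF two] two)
qed

text \<open>
  The hypotheses only exclude coincidences among the four vectors. This suffices, since over \<open>F\<^sub>2\<close>
  the only possible linear relations between \<open>x\<close> and \<open>y\<close> are \<open>x = 0\<close>, \<open>y = 0\<close> and \<open>x + y = 0\<close>.
\<close>
lemma plane_in_grassmannian:
  fixes x y :: "'a::field vec"
  assumes two: "card (UNIV :: 'a set) = 2"
    and x: "x \<in> carrier_vec n" and y: "y \<in> carrier_vec n"
    and ne: "x \<noteq> 0\<^sub>v n" "y \<noteq> 0\<^sub>v n" "x \<noteq> y"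
  shows "{0\<^sub>v n, x, y, x + y} \<in> grassmannian n 2"
proof -
  have sums: "x + (x + y) = y" "y + (x + y) = x" "x + y + x = y" "x + y + y = x" "y + x = x + y"
    "x + x = 0\<^sub>v n" "y + y = 0\<^sub>v n" "x + y + (x + y) = 0\<^sub>v n"
    using x y
    by (auto simp: ac_simps two_element_field_add_cancel_left[OF two]
          two_element_field_two_eq_zero[OF two] intro!: eq_vecI)
  have "x + y \<noteq> 0\<^sub>v n" "x + y \<noteq> x" "x + y \<noteq> y"
    using sums ne vec_add_eq_zero_iff[OF two x y] by auto
  then have "card {0\<^sub>v n, x, y, x + y} = 4"
    using ne by auto
  then show ?thesis
    using x y by (auto simp: grassmannian_iff_add_closed[OF two] sums)
qed

text \<open>In characteristic two, subtracting \<open>a\<close> is adding \<open>a\<close>.\<close>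
lemma mem_coset_iff:
  fixes a v :: "'a::field vec"
  assumes two: "card (UNIV :: 'a set) = 2" and W: "W \<subseteq> carrier_vec n"
    and a: "a \<in> carrier_vec n" and v: "v \<in> carrier_vec n"
  shows "v \<in> (+) a ` W \<longleftrightarrow> a + v \<in> W"
proof
  assume "v \<in> (+) a ` W"
  then obtain w where "w \<in> W" "v = a + w"
    by blast
  then show "a + v \<in> W"
    using vec_add_cancel_left[OF two a, of w] W by auto
next
  assume "a + v \<in> W"
  then show "v \<in> (+) a ` W"
    using vec_add_cancel_left[OF two a v] by (metis imageI)
qed

text \<open>
  For the uniqueness of blocks: every block through \<open>a\<close> may be taken to be a translate by \<open>a\<close>.
\<close>
lemma coset_eq_if_mem:
  fixes a b :: "'a::field vec"
  assumes two: "card (UNIV :: 'a set) = 2" and W: "W \<in> grassmannian n k"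
    and a: "a \<in> carrier_vec n" and b: "b \<in> carrier_vec n" and mem: "a \<in> (+) b ` W"
  shows "(+) b ` W = (+) a ` W"
proof -
  have sub: "W \<subseteq> carrier_vec n" and add: "\<And>v w. v \<in> W \<Longrightarrow> w \<in> W \<Longrightarrow> v + w \<in> W"
    using W by (auto simp: grassmannian_iff_add_closed[OF two])
  have ba: "b + a \<in> W"
    using mem mem_coset_iff[OF two sub b a] by simp
  have "b + v \<in> W \<longleftrightarrow> a + v \<in> W" if v: "v \<in> carrier_vec n" for v
  proof -
    have 1: "b + a + (b + v) = a + v" and 2: "b + a + (a + v) = b + v"
      using a b v
      by (auto simp: ac_simps two_element_field_add_cancel_left[OF two] intro!: eq_vecI)
    show ?thesis
      using add[OF ba] 1 2 by metis
  qed
  then have "v \<in> (+) b ` W \<longleftrightarrow> v \<in> (+) a ` W" if "v \<in> carrier_vec n" for v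
    using that mem_coset_iff[OF two sub a that] mem_coset_iff[OF two sub b that] by simp
  moreover have "(+) a ` W \<subseteq> carrier_vec n" "(+) b ` W \<subseteq> carrier_vec n"
    using sub a b by auto
  ultimately show ?thesis
    by blast
qed

section \<open>The Steiner system of cosets\<close>

theorem steiner_system_cosets:
  fixes SS :: "'a::field vec set set"
  assumes two: "card (UNIV :: 'a set) = 2"
    and SS: "steiner_structure 2 k n SS"
  shows "steiner_system 3 (2 ^ k) (2 ^ n) (carrier_vec n)
           {(+) a ` W | a W. a \<in> carrier_vec n \<and> W \<in> SS}"
proof -
  define \<B> where "\<B> = {(+) a ` W | a W. a \<in> carrier_vec n \<and> W \<in> SS}"
  have gr: "W \<in> grassmannian n k" if "W \<in> SS" for W
    using SS that unfolding steiner_structure_def by blast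
  have sub: "W \<subseteq> carrier_vec n" if "W \<in> SS" for W
    using gr[OF that] by (simp add: grassmannian_iff_add_closed[OF two])
  have points: "card (carrier_vec n :: 'a vec set) = 2 ^ n"
    by (simp add: card_carrier_vec two)
  then have fin: "finite (carrier_vec n :: 'a vec set)"
    by (metis card.infinite power_not_zero zero_neq_numeral)
  have blocks: "B \<subseteq> carrier_vec n \<and> card B = 2 ^ k" if B_mem: "B \<in> \<B>" for B
  proof -
    obtain a W where a: "a \<in> carrier_vec n" and W: "W \<in> SS" and B: "B = (+) a ` W"
      using B_mem unfolding \<B>_def by blast
    have "inj_on ((+) a) W"
    proof (rule inj_onI)
      fix v w
      assume "v \<in> W" "w \<in> W" "a + v = a + w"
      then show "v = w"
        using vec_add_cancel_left[OF two a, of v] vec_add_cancel_left[OF two a, of w] sub[OF W]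
        by auto
    qed
    then have "card B = 2 ^ k"
      using gr[OF W] by (simp add: B card_image grassmannian_iff_add_closed[OF two])
    then show ?thesis
      using sub[OF W] a B by auto
  qed
  have triples: "\<exists>!B. B \<in> \<B> \<and> T \<subseteq> B" if T: "T \<subseteq> carrier_vec n" "card T = 3" for T
  proof -
    obtain a b c where abc: "T = {a, b, c}" "a \<noteq> b" "a \<noteq> c" "b \<noteq> c"
      using T(2) by (auto simp: card_3_iff)
    have a: "a \<in> carrier_vec n" and b: "b \<in> carrier_vec n" and c: "c \<in> carrier_vec n"
      using T(1) abc by auto
    define U where "U = {0\<^sub>v n, a + b, a + c, a + b + (a + c)}"
    have "a + b \<noteq> a + c"
      using vec_add_cancel_left[OF two a b] vec_add_cancel_left[OF two a c] abc by metis
    then have "U \<in> grassmannian n 2"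
      unfolding U_def using abc a b c vec_add_eq_zero_iff[OF two a]
      by (intro plane_in_grassmannian[OF two]) auto
    then have "\<exists>!W. W \<in> SS \<and> U \<subseteq> W"
      using SS unfolding steiner_structure_def by blast
    then obtain W where W: "W \<in> SS" "U \<subseteq> W"
      and unique: "\<And>W'. W' \<in> SS \<Longrightarrow> U \<subseteq> W' \<Longrightarrow> W' = W"
      by (elim ex1E) blast
    \<comment> \<open>The blocks through \<open>T\<close> thus correspond to the members above the plane \<open>U\<close>.\<close>
    have through: "T \<subseteq> (+) a ` W' \<longleftrightarrow> U \<subseteq> W'" if W': "W' \<in> SS" for W'
    proof -
      have zero: "0\<^sub>v n \<in> W'" and add: "a + b + (a + c) \<in> W'" if "a + b \<in> W'" "a + c \<in> W'"
        using gr[OF W'] that by (auto simp: grassmannian_iff_add_closed[OF two])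
      have "T \<subseteq> (+) a ` W' \<longleftrightarrow> a + a \<in> W' \<and> a + b \<in> W' \<and> a + c \<in> W'"
        using mem_coset_iff[OF two sub[OF W'] a] a b c by (simp only: abc(1) insert_subset) simp
      then show ?thesis
        unfolding U_def vec_add_self[OF two a] using zero add by blast
    qed
    show ?thesis
    proof (intro ex1I conjI)
      show "(+) a ` W \<in> \<B>" unfolding \<B>_def using a W(1) by blast
      show "T \<subseteq> (+) a ` W" using W through by simp
      fix B
      assume B_mem: "B \<in> \<B> \<and> T \<subseteq> B"
      then obtain b' W' where b': "b' \<in> carrier_vec n" and W': "W' \<in> SS" and B: "B = (+) b' ` W'"
        unfolding \<B>_def by blast
      have "a \<in> (+) b' ` W'"
        using B_mem B abc(1) by simp
      then have "B = (+) a ` W'"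
        using coset_eq_if_mem[OF two gr[OF W'] a b'] B by simp
      moreover from this have "W' = W"
        using through[OF W'] B_mem unique[OF W'] by simp
      ultimately show "B = (+) a ` W" by simp
    qed
  qed
  show ?thesis
    unfolding steiner_system_def \<B>_def[symmetric] using fin points blocks triples by simp
qed

lemma steiner_system_image:
  assumes S: "steiner_system r k v X \<B>" and f: "bij_betw f X Y"
  shows "steiner_system r k v Y ((`) f ` \<B>)"
proof -
  have inj: "inj_on f X" and Y: "f ` X = Y"
    using f by (auto simp: bij_betw_def)
  have fin: "finite X" and v: "card X = v"
    and B: "\<And>B. B \<in> \<B> \<Longrightarrow> B \<subseteq> X \<and> card B = k"
    and T: "\<And>T. T \<subseteq> X \<Longrightarrow> card T = r \<Longrightarrow> \<exists>!B. B \<in> \<B> \<and> T \<subseteq> B"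
    using S unfolding steiner_system_def by simp_all
  have cover: "\<exists>!C. C \<in> (`) f ` \<B> \<and> T' \<subseteq> C" if T': "T' \<subseteq> Y" "card T' = r" for T'
  proof -
    obtain T where "T \<subseteq> X" and T'_eq: "T' = f ` T"
      using T'(1) Y by (metis subset_image_iff)
    have "card T = r"
      using T'(2) T'_eq card_image[OF inj_on_subset[OF inj \<open>T \<subseteq> X\<close>]] by simp
    have iff: "T' \<subseteq> f ` B \<longleftrightarrow> T \<subseteq> B" if "B \<in> \<B>" for B
    proof
      assume "T' \<subseteq> f ` B"
      then show "T \<subseteq> B"
        using inj_on_image_mem_iff[OF inj] \<open>T \<subseteq> X\<close> B[OF that] T'_eq by blast
    qed (auto simp: T'_eq)
    obtain B where "B \<in> \<B>" "T \<subseteq> B" and unique: "\<And>B'. B' \<in> \<B> \<Longrightarrow> T \<subseteq> B' \<Longrightarrow> B' = B"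
      using T[OF \<open>T \<subseteq> X\<close> \<open>card T = r\<close>] by (elim ex1E) blast
    then show ?thesis
    proof (intro ex1I conjI)
      show "f ` B \<in> (`) f ` \<B>" using \<open>B \<in> \<B>\<close> by blast
      show "T' \<subseteq> f ` B" using \<open>T \<subseteq> B\<close> by (auto simp: T'_eq)
      fix C
      assume C: "C \<in> (`) f ` \<B> \<and> T' \<subseteq> C"
      then obtain B' where B': "B' \<in> \<B>" "C = f ` B'"
        by blast
      then have "B' = B"
        using C iff unique by simp
      then show "C = f ` B"
        using B' by simp
    qed
  qed
  have "finite Y" "card Y = v"
    using fin v Y card_image[OF inj] by auto
  moreover have "C \<subseteq> Y \<and> card C = k" if C: "C \<in> (`) f ` \<B>" for C
  proof -
    obtain B' where "B' \<in> \<B>" "C = f ` B'"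
      using C by blast
    then show ?thesis
      using B[of B'] Y card_image[OF inj_on_subset[OF inj, of B']] by auto
  qed
  ultimately show ?thesis
    unfolding steiner_system_def using cover by simp
qed

theorem theorem4:
  fixes n k :: nat
  assumes "card (UNIV :: 'a::field set) = 2"
    and "2 \<le> k" and "k \<le> n"
    and "\<exists>SS :: 'a vec set set. steiner_structure 2 k n SS"
  shows "\<exists>(X :: nat set) \<B>. steiner_system 3 (2 ^ k) (2 ^ n) X \<B>"
proof -
  obtain SS :: "'a vec set set" where "steiner_structure 2 k n SS"
    using assms(4) by blast
  then obtain \<B> where S: "steiner_system 3 (2 ^ k) (2 ^ n) (carrier_vec n :: 'a vec set) \<B>"
    using steiner_system_cosets[OF assms(1)] by blast
  then have "finite (carrier_vec n :: 'a vec set)"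
    by (simp add: steiner_system_def)
  then obtain f :: "'a vec \<Rightarrow> nat"
    where "bij_betw f (carrier_vec n) {0..<card (carrier_vec n :: 'a vec set)}"
    using ex_bij_betw_finite_nat by blast
  then show ?thesis
    using steiner_system_image[OF S] by blast
qed

end
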